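(* Let $(f_E,\tau)$ be a fuzzy soft topological space and let $g_A$ be a fuzzy soft set in it. Then $g_A$ is semiopen if and only if for every fuzzy soft point $e_{p_A}\,\widetilde{\in}\, g_A$ there exists a semiopen fuzzy soft set $h_A$ such that $e_{p_A}\,\widetilde{\in}\, h_A\,\widetilde{\subseteq}\, g_A$.
   Context: Let $U$ be a universe and $E$ a set of parameters. A fuzzy soft set $g_A$ over $U$ (with $A\subseteq E$) is a map $g$ assigning to each parameter $e\in E$ a fuzzy set $g(e):U\to[0,1]$, with $g(e)$ the zero fuzzy set for $e\notin A$. Inclusion $\widetilde{\subseteq}$, union $\widetilde{\bigcup}$ and intersection $\widetilde{\bigcap}$ are defined pointwise (by $\le$, supremum and infimum of membership values, for each parameter $e$ and each element of $U$). $\widetilde{\Phi}_E$ is the fuzzy soft set all of whose values are the zero fuzzy set. Fix a fuzzy soft set $f_E$. All fuzzy soft sets considered are fuzzy soft subsets of $f_E$ (i.e. $g_A\,\widetilde{\subseteq}\, f_E$). The complement of $g_A$ is taken relative to $f_E$: $g^c(e)(x)=f(e)(x)-g(e)(x)$. A fuzzy soft topology on $f_E$ is a family $\tau$ of fuzzy soft subsets of $f_E$ containing $\widetilde{\Phi}_E$ and $f_E$ and closed under intersections of two members and arbitrary unions; $(f_E,\tau)$ is then a fuzzy soft topological space. Members of $\tau$ are called open fuzzy soft sets and their complements closed fuzzy soft sets. The closure $cl(g_A)$ is the intersection of all closed fuzzy soft sets containing $g_A$. A fuzzy soft set $g_A$ is semiopen if there is an open fuzzy soft set $h_A$ with $h_A\,\widetilde{\subseteq}\,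 g_A\,\widetilde{\subseteq}\, cl(h_A)$. A fuzzy soft set $p_A$ is called a fuzzy soft point, denoted $e_{p_A}$, if for the element $e\in A$ the fuzzy set $p(e)$ is not the zero fuzzy set and $p(e')$ is the zero fuzzy set for all $e'\in A\setminus\{e\}$. The fuzzy soft point $e_{p_A}$ is said to be in a fuzzy soft set $h_A$, written $e_{p_A}\,\widetilde{\in}\, h_A$, if $p(e)\le h(e)$ pointwise on $U$. *)

theory Defs
  imports Complex_Main
begin

text \<open>
  Fuzzy soft sets over a universe \<open>U\<close> with parameters \<open>E\<close> are functions \<open>'e \<Rightarrow> 'u \<Rightarrow> real\<close>.
  Membership values at parameters outside \<open>E\<close> or points outside \<open>U\<close> are fixed to be 0, so that
  equality of fuzzy soft sets is equality of functions and inclusion is the pointwise order.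
\<close>

definition fuzzy_set :: "'u set \<Rightarrow> ('u \<Rightarrow> real) \<Rightarrow> bool" where
  "fuzzy_set U m \<longleftrightarrow> (\<forall>x\<in>U. 0 \<le> m x \<and> m x \<le> 1) \<and> (\<forall>x. x \<notin> U \<longrightarrow> m x = 0)"

definition zero_fuzzy_set :: "'u \<Rightarrow> real" where
  "zero_fuzzy_set = (\<lambda>x. 0)"

definition fuzzy_soft_set :: "'u set \<Rightarrow> 'e set \<Rightarrow> 'e set \<Rightarrow> ('e \<Rightarrow> 'u \<Rightarrow> real) \<Rightarrow> bool" where
  "fuzzy_soft_set U E A g \<longleftrightarrow>
     A \<subseteq> E \<and> (\<forall>e\<in>E. fuzzy_set U (g e)) \<and> (\<forall>e. e \<notin> A \<longrightarrow> g e = zero_fuzzy_set)"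

abbreviation fs_subset :: "('e \<Rightarrow> 'u \<Rightarrow> real) \<Rightarrow> ('e \<Rightarrow> 'u \<Rightarrow> real) \<Rightarrow> bool"
    (infix "\<subseteq>\<^sub>f" 50) where
  "g \<subseteq>\<^sub>f h \<equiv> g \<le> h"

definition fs_empty :: "'e \<Rightarrow> 'u \<Rightarrow> real" where
  "fs_empty = (\<lambda>e. zero_fuzzy_set)"

abbreviation fs_inter :: "('e \<Rightarrow> 'u \<Rightarrow> real) \<Rightarrow> ('e \<Rightarrow> 'u \<Rightarrow> real) \<Rightarrow> ('e \<Rightarrow> 'u \<Rightarrow> real)"
    (infixl "\<inter>\<^sub>f" 70) where
  "g \<inter>\<^sub>f h \<equiv> inf g h"

text \<open>
  Suprema and infima of membership values are taken in the lattice \<open>[0,1]\<close>; inserting 0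
  resp. 1 only matters for the empty family, where \<open>Sup\<close> and \<open>Inf\<close> on the reals are unspecified.
\<close>

definition fs_Union :: "('e \<Rightarrow> 'u \<Rightarrow> real) set \<Rightarrow> ('e \<Rightarrow> 'u \<Rightarrow> real)" where
  "fs_Union F = (\<lambda>e x. Sup (insert 0 ((\<lambda>g. g e x) ` F)))"

definition fs_Inter ::
    "'u set \<Rightarrow> 'e set \<Rightarrow> ('e \<Rightarrow> 'u \<Rightarrow> real) set \<Rightarrow> ('e \<Rightarrow> 'u \<Rightarrow> real)" where
  "fs_Inter U E F =
     (\<lambda>e x. if e \<in> E \<and> x \<in> U then Inf (insert 1 ((\<lambda>g. g e x) ` F)) else 0)"

definition fs_complement ::
    "('e \<Rightarrow> 'u \<Rightarrow> real) \<Rightarrow> ('e \<Rightarrow> 'u \<Rightarrow> real) \<Rightarrow> ('e \<Rightarrow> 'u \<Rightarrow> real)" where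
  "fs_complement f g = (\<lambda>e x. f e x - g e x)"

definition fs_topology ::
    "'u set \<Rightarrow> 'e set \<Rightarrow> ('e \<Rightarrow> 'u \<Rightarrow> real) \<Rightarrow> ('e \<Rightarrow> 'u \<Rightarrow> real) set \<Rightarrow> bool" where
  "fs_topology U E f \<tau> \<longleftrightarrow>
     (\<forall>g\<in>\<tau>. (\<exists>A. fuzzy_soft_set U E A g) \<and> g \<subseteq>\<^sub>f f) \<and>
     fs_empty \<in> \<tau> \<and> f \<in> \<tau> \<and>
     (\<forall>g\<in>\<tau>. \<forall>h\<in>\<tau>. g \<inter>\<^sub>f h \<in> \<tau>) \<and>
     (\<forall>F. F \<subseteq> \<tau> \<longrightarrow> fs_Union F \<in> \<tau>)"

definition fs_topological_space ::
    "'u set \<Rightarrow> 'e set \<Rightarrow> ('e \<Rightarrow> 'u \<Rightarrow> real) \<Rightarrow> ('e \<Rightarrow> 'u \<Rightarrow> real) set \<Rightarrow> bool" where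
  "fs_topological_space U E f \<tau> \<longleftrightarrow> fuzzy_soft_set U E E f \<and> fs_topology U E f \<tau>"

definition fs_closed ::
    "('e \<Rightarrow> 'u \<Rightarrow> real) \<Rightarrow> ('e \<Rightarrow> 'u \<Rightarrow> real) set \<Rightarrow> ('e \<Rightarrow> 'u \<Rightarrow> real) \<Rightarrow> bool" where
  "fs_closed f \<tau> k \<longleftrightarrow> (\<exists>g\<in>\<tau>. k = fs_complement f g)"

definition fs_closure ::
    "'u set \<Rightarrow> 'e set \<Rightarrow> ('e \<Rightarrow> 'u \<Rightarrow> real) \<Rightarrow> ('e \<Rightarrow> 'u \<Rightarrow> real) set \<Rightarrow>
     ('e \<Rightarrow> 'u \<Rightarrow> real) \<Rightarrow> ('e \<Rightarrow> 'u \<Rightarrow> real)" where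
  "fs_closure U E f \<tau> g = fs_Inter U E {k. fs_closed f \<tau> k \<and> g \<subseteq>\<^sub>f k}"

definition fs_semiopen ::
    "'u set \<Rightarrow> 'e set \<Rightarrow> ('e \<Rightarrow> 'u \<Rightarrow> real) \<Rightarrow> ('e \<Rightarrow> 'u \<Rightarrow> real) set \<Rightarrow>
     ('e \<Rightarrow> 'u \<Rightarrow> real) \<Rightarrow> bool" where
  "fs_semiopen U E f \<tau> g \<longleftrightarrow>
     (\<exists>A. fuzzy_soft_set U E A g) \<and> g \<subseteq>\<^sub>f f \<and>
     (\<exists>h\<in>\<tau>. h \<subseteq>\<^sub>f g \<and> g \<subseteq>\<^sub>f fs_closure U E f \<tau> h)"

definition fs_point ::
    "'u set \<Rightarrow> 'e set \<Rightarrow> 'e set \<Rightarrow> 'e \<Rightarrow> ('e \<Rightarrow> 'u \<Rightarrow> real) \<Rightarrow> bool" where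
  "fs_point U E A e p \<longleftrightarrow>
     fuzzy_soft_set U E A p \<and> e \<in> A \<and> p e \<noteq> zero_fuzzy_set \<and>
     (\<forall>e'\<in>A - {e}. p e' = zero_fuzzy_set)"

definition fs_point_in :: "'e \<Rightarrow> ('e \<Rightarrow> 'u \<Rightarrow> real) \<Rightarrow> ('e \<Rightarrow> 'u \<Rightarrow> real) \<Rightarrow> bool" where
  "fs_point_in e p h \<longleftrightarrow> p e \<le> h e"

end

theory Submission
  imports Defs
begin

text \<open>
  Let \<open>int g\<close> be the union of all open fuzzy soft sets below \<open>g\<close>. It is the largest open fuzzy
  soft set below \<open>g\<close>, and closure is monotone, so \<open>g\<close> is semiopen iff \<open>g \<le> cl (int g)\<close>: any open
  witness of semiopenness may be replaced by \<open>int g\<close>.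

  The inequality \<open>g \<le> cl (int g)\<close> can be checked one parameter at a time. Where \<open>g e\<close> is the zero
  fuzzy set it holds because closures are nonnegative. Otherwise the restriction of \<open>g\<close> to the
  single parameter \<open>e\<close> is a fuzzy soft point in \<open>g\<close>. A semiopen \<open>h \<le> g\<close> that contains this point
  agrees with \<open>g\<close> at \<open>e\<close>, and \<open>h \<le> cl (int h) \<le> cl (int g)\<close> gives the bound at \<open>e\<close>. In the
  other direction, \<open>h = g\<close> works for every point.
\<close>

definition fs_interior :: "('e \<Rightarrow> 'u \<Rightarrow> real) set \<Rightarrow> ('e \<Rightarrow> 'u \<Rightarrow> real) \<Rightarrow> ('e \<Rightarrow> 'u \<Rightarrow> real)" where
  "fs_interior \<tau> g = fs_Union {k \<in> \<tau>. k \<subseteq>\<^sub>f g}"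

lemma fuzzy_soft_set_nonneg:
  assumes "fuzzy_soft_set U E A g"
  shows "0 \<le> g e x"
proof (cases "e \<in> A \<and> x \<in> U")
  case True
  then show ?thesis
    using assms by (auto simp: fuzzy_soft_set_def fuzzy_set_def)
next
  case False
  then show ?thesis
    using assms by (force simp: fuzzy_soft_set_def fuzzy_set_def zero_fuzzy_set_def)
qed

lemma fs_Union_upper:
  assumes "k \<in> F" and "\<And>k. k \<in> F \<Longrightarrow> k \<subseteq>\<^sub>f f"
  shows "k \<subseteq>\<^sub>f fs_Union F"
proof (intro le_funI)
  fix e x
  have "bdd_above ((\<lambda>k. k e x) ` F)"
    using assms(2) by (intro bdd_aboveI[where M = "f e x"]) (auto simp: le_fun_def)
  then show "k e x \<le> fs_Union F e x"
    using assms(1) unfolding fs_Union_def by (intro cSup_upper) auto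
qed

lemma fs_Union_least:
  assumes "\<And>k. k \<in> F \<Longrightarrow> k \<subseteq>\<^sub>f g" and "\<And>e x. 0 \<le> g e x"
  shows "fs_Union F \<subseteq>\<^sub>f g"
proof (intro le_funI)
  fix e x
  show "fs_Union F e x \<le> g e x"
    using assms unfolding fs_Union_def
    by (intro cSup_least) (auto simp: le_fun_def)
qed

lemma fs_Inter_nonneg:
  assumes "\<And>k e x. k \<in> F \<Longrightarrow> 0 \<le> k e x"
  shows "0 \<le> fs_Inter U E F e x"
  using assms unfolding fs_Inter_def by (auto intro!: cInf_greatest)

lemma fs_Inter_antimono:
  assumes "G \<subseteq> F" and "\<And>k e x. k \<in> F \<Longrightarrow> 0 \<le> k e x"
  shows "fs_Inter U E F \<subseteq>\<^sub>f fs_Inter U E G"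
proof (intro le_funI)
  fix e x
  have "bdd_below ((\<lambda>k. k e x) ` F)"
    using assms(2) by (intro bdd_belowI[where m = 0]) auto
  then have "Inf (insert 1 ((\<lambda>k. k e x) ` F)) \<le> Inf (insert 1 ((\<lambda>k. k e x) ` G))"
    using assms(1) by (intro cInf_superset_mono) auto
  then show "fs_Inter U E F e x \<le> fs_Inter U E G e x"
    by (simp add: fs_Inter_def)
qed

lemma fs_closed_nonneg:
  assumes "fs_topological_space U E f \<tau>" and "fs_closed f \<tau> k"
  shows "0 \<le> k e x"
  using assms
  by (auto simp: fs_topological_space_def fs_topology_def fs_closed_def fs_complement_def le_fun_def)

lemma fs_closure_nonneg:
  assumes "fs_topological_space U E f \<tau>"
  shows "0 \<le> fs_closure U E f \<tau> g e x"
  unfolding fs_closure_def using fs_closed_nonneg[OF assms] by (auto intro: fs_Inter_nonneg)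

lemma fs_closure_mono:
  assumes "fs_topological_space U E f \<tau>" and "g \<subseteq>\<^sub>f h"
  shows "fs_closure U E f \<tau> g \<subseteq>\<^sub>f fs_closure U E f \<tau> h"
  unfolding fs_closure_def using fs_closed_nonneg[OF assms(1)] assms(2)
  by (intro fs_Inter_antimono) auto

lemma fs_interior_open:
  assumes "fs_topological_space U E f \<tau>"
  shows "fs_interior \<tau> g \<in> \<tau>"
  using assms by (auto simp: fs_topological_space_def fs_topology_def fs_interior_def)

lemma fs_interior_subset:
  assumes "fuzzy_soft_set U E A g"
  shows "fs_interior \<tau> g \<subseteq>\<^sub>f g"
  unfolding fs_interior_def using fuzzy_soft_set_nonneg[OF assms] by (intro fs_Union_least) auto

lemma open_subset_fs_interior:
  assumes "k \<in> \<tau>" and "k \<subseteq>\<^sub>f g"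
  shows "k \<subseteq>\<^sub>f fs_interior \<tau> g"
  unfolding fs_interior_def using assms by (intro fs_Union_upper[where f = g]) auto

text \<open>
  An open \<open>k \<le> h\<close> with \<open>h \<le> cl k\<close> lies below \<open>int g\<close>, so \<open>cl k \<le> cl (int g)\<close>. The resulting bound
  does not depend on \<open>h\<close>, which allows the semiopen sets found at different fuzzy soft points of
  \<open>g\<close> to be combined.
\<close>

lemma fs_semiopen_subset_closure_interior:
  assumes "fs_topological_space U E f \<tau>" and "fs_semiopen U E f \<tau> h" and "h \<subseteq>\<^sub>f g"
  shows "h \<subseteq>\<^sub>f fs_closure U E f \<tau> (fs_interior \<tau> g)"
proof -
  obtain k where k: "k \<in> \<tau>" "k \<subseteq>\<^sub>f h" "h \<subseteq>\<^sub>f fs_closure U E f \<tau> k"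
    using assms(2) by (auto simp: fs_semiopen_def)
  have "k \<subseteq>\<^sub>f fs_interior \<tau> g"
    using k(1) order_trans[OF k(2) assms(3)] by (rule open_subset_fs_interior)
  then show ?thesis
    using k(3) fs_closure_mono[OF assms(1)] order_trans by blast
qed

lemma fs_semiopen_iff_subset_closure_interior:
  assumes "fs_topological_space U E f \<tau>"
    and "fuzzy_soft_set U E A g" and "g \<subseteq>\<^sub>f f"
  shows "fs_semiopen U E f \<tau> g \<longleftrightarrow> g \<subseteq>\<^sub>f fs_closure U E f \<tau> (fs_interior \<tau> g)"
proof
  assume "fs_semiopen U E f \<tau> g"
  then show "g \<subseteq>\<^sub>f fs_closure U E f \<tau> (fs_interior \<tau> g)"
    using fs_semiopen_subset_closure_interior[OF assms(1)] by blast
next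
  assume "g \<subseteq>\<^sub>f fs_closure U E f \<tau> (fs_interior \<tau> g)"
  then show "fs_semiopen U E f \<tau> g"
    unfolding fs_semiopen_def
    using fs_interior_open[OF assms(1)] fs_interior_subset[OF assms(2)] assms(2,3) by blast
qed

lemma fs_point_restrict:
  assumes "fuzzy_soft_set U E A g" and "g e \<noteq> zero_fuzzy_set"
  shows "fs_point U E A e (\<lambda>e'. if e' = e then g e else zero_fuzzy_set)"
proof -
  have "e \<in> A"
    using assms by (auto simp: fuzzy_soft_set_def)
  then show ?thesis
    using assms
    by (auto simp: fs_point_def fuzzy_soft_set_def fuzzy_set_def zero_fuzzy_set_def)
qed

theorem theorem2p11:
  fixes U :: "'u set" and E A :: "'e set"
    and f g :: "'e \<Rightarrow> 'u \<Rightarrow> real" and \<tau> :: "('e \<Rightarrow> 'u \<Rightarrow> real) set"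
  assumes "fs_topological_space U E f \<tau>"
    and "fuzzy_soft_set U E A g" and "g \<subseteq>\<^sub>f f"
  shows "fs_semiopen U E f \<tau> g \<longleftrightarrow>
    (\<forall>B e p. fs_point U E B e p \<and> p \<subseteq>\<^sub>f f \<and> fs_point_in e p g \<longrightarrow>
       (\<exists>h. fs_semiopen U E f \<tau> h \<and> fs_point_in e p h \<and> h \<subseteq>\<^sub>f g))"
    (is "_ \<longleftrightarrow> ?points")
proof
  assume "fs_semiopen U E f \<tau> g"
  then show ?points
    by blast
next
  assume points: ?points
  have "g e x \<le> fs_closure U E f \<tau> (fs_interior \<tau> g) e x" for e x
  proof (cases "g e = zero_fuzzy_set")
    case True
    then show ?thesis
      using fs_closure_nonneg[OF assms(1)] by (simp add: zero_fuzzy_set_def)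
  next
    case False
    define p where "p = (\<lambda>e'. if e' = e then g e else zero_fuzzy_set)"
    have "fs_point U E A e p"
      unfolding p_def using assms(2) False by (rule fs_point_restrict)
    moreover have "p \<subseteq>\<^sub>f f"
    proof (rule order_trans)
      show "p \<subseteq>\<^sub>f g"
        using fuzzy_soft_set_nonneg[OF assms(2)]
        by (auto simp: p_def le_fun_def zero_fuzzy_set_def)
    qed (rule assms(3))
    moreover have "fs_point_in e p g"
      by (simp add: fs_point_in_def p_def)
    ultimately obtain h where h: "fs_semiopen U E f \<tau> h" "fs_point_in e p h" "h \<subseteq>\<^sub>f g"
      using points by blast
    have "g e x \<le> h e x"
      using h(2) by (simp add: fs_point_in_def p_def le_fun_def)
    also have "\<dots> \<le> fs_closure U E f \<tau> (fs_interior \<tau> g) e x"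
      using fs_semiopen_subset_closure_interior[OF assms(1) h(1,3)] by (simp add: le_fun_def)
    finally show ?thesis .
  qed
  then show "fs_semiopen U E f \<tau> g"
    by (simp add: fs_semiopen_iff_subset_closure_interior[OF assms] le_fun_def)
qed

end
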